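(* Let $C>0$. If $(\mathbf{w}^*;b^*;\mathbf{u}^* )\in\mathbb{R}^n\times\mathbb{R}\times\mathbb{R}^m$, with some $\boldsymbol{\lambda}^*\in\mathbb{R}^m$ and $\gamma>0$, is a P-stationary point of the problem $$\min_{\mathbf{w}\in\mathbb{R}^n,\,b\in\mathbb{R},\,\mathbf{u}\in\mathbb{R}^m}\ \frac12\|\mathbf{w}\|^2+CL_r(\mathbf{u})\quad\text{s.t.}\quad \mathbf{u}+A\mathbf{w}+b\mathbf{y}=\mathbf{1},$$ then $(\mathbf{w}^*;b^*;\mathbf{u}^* )$ is a local minimizer of this (constrained) problem.
   Context: Data: $(\mathbf{x}_i,y_i)$, $i=1,\dots,m$, with $\mathbf{x}_i\in\mathbb{R}^n$, $y_i\in\{-1,1\}$; $A=[y_1\mathbf{x}_1\ y_2\mathbf{x}_2\cdots y_m\mathbf{x}_m]^\top\in\mathbb{R}^{m\times n}$, $\mathbf{y}=(y_1,\dots,y_m)^\top$, $\mathbf{1}=(1,\dots,1)^\top\in\mathbb{R}^m$. The ramp loss is $\ell_r(t)=1$ for $t\ge1$, $\ell_r(t)=t$ for $0\le t<1$, $\ell_r(t)=0$ for $t<0$, and $L_r(\mathbf{u})=\sum_{i=1}^m\ell_r(u_i)$. All norms are Euclidean. For $\gamma>0$ and $\mathbf{s}\in\mathbb{R}^m$, the set-valued proximal operator is $\mathrm{prox}_{\gamma CL_r}(\mathbf{s})=\arg\min_{\mathbf{v}\in\mathbb{R}^m} CL_r(\mathbf{v})+\frac1{2\gamma}\|\mathbf{v}-\mathbf{s}\|^2$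 (the set of all global minimizers). $(\mathbf{w}^*;b^*;\mathbf{u}^* )$ with $\boldsymbol{\lambda}^*\in\mathbb{R}^m$ and $\gamma>0$ is a P-stationary (proximal stationary) point of the problem if $$\mathbf{w}^*+A^\top\boldsymbol{\lambda}^*=\mathbf{0},\quad \langle\mathbf{y},\boldsymbol{\lambda}^*\rangle=0,\quad \mathbf{u}^*+A\mathbf{w}^*+b^*\mathbf{y}=\mathbf{1},\quad \mathbf{u}^*\in\mathrm{prox}_{\gamma CL_r}(\mathbf{u}^*-\gamma\boldsymbol{\lambda}^* ).$$ *)

theory Defs
  imports "HOL-Analysis.Analysis"
begin

definition ramp_loss :: "real \<Rightarrow> real" where
  "ramp_loss t = (if t \<ge> 1 then 1 else if t \<ge> 0 then t else 0)"

definition total_ramp_loss :: "real ^ 'm \<Rightarrow> real" where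
  "total_ramp_loss u = (\<Sum>i\<in>UNIV. ramp_loss (u $ i))"

text \<open>The samples are the rows of \<open>x\<close>; row \<open>i\<close> of the matrix below is \<open>y\<^sub>i x\<^sub>i\<close>.\<close>

definition data_matrix :: "real ^ 'n ^ 'm \<Rightarrow> real ^ 'm \<Rightarrow> real ^ 'n ^ 'm" where
  "data_matrix x y = (\<chi> i. y $ i *\<^sub>R x $ i)"

text \<open>The set of all global minimizers, without any convexity assumption on \<open>f\<close>.\<close>

definition prox :: "real \<Rightarrow> ('a::real_normed_vector \<Rightarrow> real) \<Rightarrow> 'a \<Rightarrow> 'a set" where
  "prox \<gamma> f s = {v. is_arg_min (\<lambda>v. f v + 1 / (2 * \<gamma>) * (norm (v - s))\<^sup>2) (\<lambda>v. True) v}"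

text \<open>On the right-hand side of the constraint, \<open>1 :: real ^ 'm\<close> is the all-ones vector.\<close>

definition feasible_set ::
    "real ^ 'n ^ 'm \<Rightarrow> real ^ 'm \<Rightarrow> ((real ^ 'n) \<times> real \<times> (real ^ 'm)) set" where
  "feasible_set x y = {(w, b, u). u + data_matrix x y *v w + b *\<^sub>R y = 1}"

definition objective :: "real \<Rightarrow> (real ^ 'n) \<times> real \<times> (real ^ 'm) \<Rightarrow> real" where
  "objective C = (\<lambda>(w, b, u). 1 / 2 * (norm w)\<^sup>2 + C * total_ramp_loss u)"

definition P_stationary ::
    "real ^ 'n ^ 'm \<Rightarrow> real ^ 'm \<Rightarrow> real \<Rightarrow> (real ^ 'n) \<times> real \<times> (real ^ 'm)
      \<Rightarrow> real ^ 'm \<Rightarrow> real \<Rightarrow> bool" where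
  "P_stationary x y C = (\<lambda>(w, b, u) lam \<gamma>.
     w + transpose (data_matrix x y) *v lam = 0 \<and>
     y \<bullet> lam = 0 \<and>
     u + data_matrix x y *v w + b *\<^sub>R y = 1 \<and>
     u \<in> prox \<gamma> (\<lambda>v. C * total_ramp_loss v) (u - \<gamma> *\<^sub>R lam))"

definition local_minimizer_on :: "('a::metric_space \<Rightarrow> real) \<Rightarrow> 'a set \<Rightarrow> 'a \<Rightarrow> bool" where
  "local_minimizer_on f S z \<longleftrightarrow> z \<in> S \<and> (\<exists>e>0. \<forall>z'\<in>S \<inter> ball z e. f z \<le> f z')"

end

theory Submission
  imports Defs
begin

text \<open>The ramp loss is piecewise linear, so near any point it is affine along segments emanating
  from that point. For such a function, scaling a displacement by \<open>s \<rightarrow> 0\<close> makes the quadratic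
  term of the proximal problem negligible, and membership in the proximal operator yields the
  first-order inequality \<open>f u \<le> f v + \<langle>\<lambda>, v - u\<rangle>\<close> for all \<open>v\<close> near \<open>u\<close>. On the feasible set the
  linear term equals \<open>\<langle>w, w' - w\<rangle>\<close>, which convexity of \<open>\<parallel>w\<parallel>\<^sup>2 / 2\<close> absorbs.\<close>

text \<open>Near \<open>a\<close>, the increment of \<open>f\<close> is positively homogeneous in
  the displacement. Stating this through segments to \<open>a\<close> avoids naming slopes, which
  differ on the two sides of a kink, and is stable under sums and scalar multiples.\<close>

definition locally_conic :: "('a::real_normed_vector \<Rightarrow> real) \<Rightarrow> 'a \<Rightarrow> bool" where
  "locally_conic f a \<longleftrightarrow>
     (\<exists>e>0. \<forall>v. norm (v - a) < e \<longrightarrow>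
       (\<forall>s\<in>{0..1}. f (a + s *\<^sub>R (v - a)) = f a + s * (f v - f a)))"

lemma locally_conic_ramp_loss: "locally_conic ramp_loss a"
proof -
  \<comment> \<open>Away from the kinks 0 and 1 this is the distance to the nearest one; at a kink
    it is the distance to the other.\<close>
  define e where "e = (if a = 0 \<or> a = 1 then 1 else min \<bar>a\<bar> \<bar>a - 1\<bar>)"
  have "e > 0"
    by (simp add: e_def)
  moreover have "ramp_loss (a + s *\<^sub>R (v - a)) = ramp_loss a + s * (ramp_loss v - ramp_loss a)"
    if v: "norm (v - a) < e" and s: "s \<in> {0..1}" for v s
  proof -
    define d where "d = s * (v - a)"
    have bd: "\<bar>d\<bar> \<le> \<bar>v - a\<bar>"
      using s by (simp add: d_def abs_mult mult_left_le_one_le)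
    \<comment> \<open>The point \<open>a + d\<close> stays on the same side of \<open>a\<close> as
      \<open>v\<close>, so at a kink both fall into the same branch of \<open>ramp_loss\<close>.
      Strictness on the left fails for \<open>s = 0\<close>, which is therefore split off.\<close>
    have sgn: "v \<ge> a \<Longrightarrow> d \<ge> 0" "v < a \<Longrightarrow> d \<le> 0" "s \<noteq> 0 \<Longrightarrow> v < a \<Longrightarrow> d < 0"
      using s by (auto simp: d_def mult_le_0_iff mult_less_0_iff)
    show ?thesis
    proof (cases "s = 0")
      case False
      consider "a < 0" | "a = 0" | "0 < a" "a < 1" | "a = 1" | "1 < a"
        by linarith
      then have "ramp_loss (a + d) = ramp_loss a + s * (ramp_loss v - ramp_loss a)"
      proof cases
        case 1
        then have "v < 0" "a + d < 0"
          using v bd by (auto simp: e_def)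
        then show ?thesis using 1 by (simp add: ramp_loss_def)
      next
        case 2
        then show ?thesis using v bd sgn False
          by (cases "v \<ge> a") (auto simp: e_def ramp_loss_def d_def)
      next
        case 3
        then have "0 < v" "v < 1" "0 < a + d" "a + d < 1"
          using v bd by (auto simp: e_def)
        then show ?thesis using 3 by (simp add: ramp_loss_def d_def)
      next
        case 4
        then show ?thesis using v bd sgn False
          by (cases "v \<ge> a") (auto simp: e_def ramp_loss_def d_def)
      next
        case 5
        then have "1 < v" "1 < a + d"
          using v bd by (auto simp: e_def)
        then show ?thesis using 5 by (simp add: ramp_loss_def)
      qed
      then show ?thesis by (simp add: d_def)
    qed simp
  qed
  ultimately show ?thesis
    unfolding locally_conic_def by blast
qed

lemma locally_conic_cmult:
  assumes "locally_conic f a"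
  shows "locally_conic (\<lambda>v. c * f v) a"
proof -
  obtain e where e: "e > 0" and
    conic: "\<And>v s. norm (v - a) < e \<Longrightarrow> s \<in> {0..1} \<Longrightarrow>
      f (a + s *\<^sub>R (v - a)) = f a + s * (f v - f a)"
    using assms unfolding locally_conic_def by blast
  have "c * f (a + s *\<^sub>R (v - a)) = c * f a + s * (c * f v - c * f a)"
    if "norm (v - a) < e" "s \<in> {0..1}" for v s
    by (simp only: conic[OF that]) (simp add: algebra_simps)
  then show ?thesis
    using e unfolding locally_conic_def by blast
qed

lemma locally_conic_sum_components:
  fixes a :: "real ^ 'm"
  assumes "\<And>i. locally_conic f (a $ i)"
  shows "locally_conic (\<lambda>u. \<Sum>i\<in>UNIV. f (u $ i)) a"
proof -
  have "\<forall>i. \<exists>e>0. \<forall>t. norm (t - a $ i) < e \<longrightarrow>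
      (\<forall>s\<in>{0..1}. f (a $ i + s *\<^sub>R (t - a $ i)) = f (a $ i) + s * (f t - f (a $ i)))"
    using assms unfolding locally_conic_def by blast
  then obtain e where pos: "\<And>i. e i > 0" and
    conic: "\<And>i t s. norm (t - a $ i) < e i \<Longrightarrow> s \<in> {0..1} \<Longrightarrow>
      f (a $ i + s *\<^sub>R (t - a $ i)) = f (a $ i) + s * (f t - f (a $ i))"
    by metis
  \<comment> \<open>One radius serves all coordinates: there are finitely many of them, and each is
    bounded by the norm.\<close>
  have "(\<Sum>i\<in>UNIV. f ((a + s *\<^sub>R (v - a)) $ i)) =
      (\<Sum>i\<in>UNIV. f (a $ i)) + s * ((\<Sum>i\<in>UNIV. f (v $ i)) - (\<Sum>i\<in>UNIV. f (a $ i)))"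
    if v: "norm (v - a) < Min (range e)" and s: "s \<in> {0..1}" for v s
  proof -
    have "f ((a + s *\<^sub>R (v - a)) $ i) = f (a $ i) + s * (f (v $ i) - f (a $ i))" for i
    proof -
      have "norm (v $ i - a $ i) \<le> norm (v - a)"
        using component_le_norm_cart[of "v - a" i] by simp
      also have "\<dots> < e i"
        using v by simp
      finally show ?thesis
        using conic[OF _ s, of "v $ i" i] by simp
    qed
    then show ?thesis
      by (simp add: sum.distrib sum_subtractf flip: sum_distrib_left)
  qed
  moreover have "Min (range e) > 0"
    using pos by auto
  ultimately show ?thesis
    unfolding locally_conic_def by blast
qed

text \<open>Expanding the square around \<open>u\<close> leaves the term
  \<open>\<gamma> / 2 * (norm lam)\<^sup>2\<close>, which does not depend on \<open>v\<close> and
  cancels when the values at \<open>u\<close> and \<open>v\<close> are compared.\<close>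

lemma prox_iff:
  fixes u lam :: "'a::real_inner"
  assumes "\<gamma> > 0"
  shows "u \<in> prox \<gamma> f (u - \<gamma> *\<^sub>R lam) \<longleftrightarrow>
    (\<forall>v. f u \<le> f v + lam \<bullet> (v - u) + (norm (v - u))\<^sup>2 / (2 * \<gamma>))"
proof -
  have "1 / (2 * \<gamma>) * (norm (v - (u - \<gamma> *\<^sub>R lam)))\<^sup>2 =
      (norm (v - u))\<^sup>2 / (2 * \<gamma>) + lam \<bullet> (v - u) + \<gamma> / 2 * (norm lam)\<^sup>2" for v
  proof -
    have "v - (u - \<gamma> *\<^sub>R lam) = (v - u) + \<gamma> *\<^sub>R lam"
      by simp
    then have "(norm (v - (u - \<gamma> *\<^sub>R lam)))\<^sup>2 =
        (norm (v - u))\<^sup>2 + 2 * \<gamma> * (lam \<bullet> (v - u)) + \<gamma>\<^sup>2 * (norm lam)\<^sup>2"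
      by (simp only: power2_norm_eq_inner)
        (simp add: inner_add_left inner_add_right inner_commute[of "v - u" lam] power2_eq_square
          distrib_left)
    then show ?thesis
      using assms by (simp add: field_simps power2_eq_square)
  qed
  then show ?thesis
    by (simp only: prox_def is_arg_min_linorder mem_Collect_eq) (simp add: add_ac)
qed

text \<open>Divide by \<open>s\<close> and let \<open>s\<close> tend to 0 from the right.\<close>

lemma nonneg_if_scaled_quadratic_nonneg:
  fixes D q :: real
  assumes "\<And>s. 0 < s \<Longrightarrow> s \<le> 1 \<Longrightarrow> 0 \<le> s * D + s\<^sup>2 * q"
  shows "0 \<le> D"
proof -
  have "0 \<le> D + s * q" if "0 < s" "s \<le> 1" for s
  proof -
    have "0 \<le> s * (D + s * q)"
      using assms[OF that] by (simp add: algebra_simps power2_eq_square)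
    then show ?thesis
      using that by (simp add: zero_le_mult_iff)
  qed
  then have "eventually (\<lambda>s. 0 \<le> D + s * q) (at_right 0)"
    by (intro eventually_at_rightI[of 0 1]) auto
  moreover have "((\<lambda>s. D + s * q) \<longlongrightarrow> D) (at_right 0)"
    by (rule tendsto_eq_intros refl | simp)+
  ultimately show ?thesis
    using tendsto_lowerbound trivial_limit_at_right_real by blast
qed

lemma prox_locally_conic:
  fixes u lam :: "'a::real_inner"
  assumes \<gamma>: "\<gamma> > 0" and u: "u \<in> prox \<gamma> f (u - \<gamma> *\<^sub>R lam)" and "locally_conic f u"
  obtains e where "e > 0" "\<And>v. norm (v - u) < e \<Longrightarrow> f u \<le> f v + lam \<bullet> (v - u)"
proof -
  obtain e where e: "e > 0" and
    conic: "\<And>v s. norm (v - u) < e \<Longrightarrow> s \<in> {0..1} \<Longrightarrow>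
      f (u + s *\<^sub>R (v - u)) = f u + s * (f v - f u)"
    using assms(3) unfolding locally_conic_def by blast
  have "f u \<le> f v + lam \<bullet> (v - u)" if v: "norm (v - u) < e" for v
  proof -
    have "0 \<le> s * (f v - f u + lam \<bullet> (v - u)) + s\<^sup>2 * ((norm (v - u))\<^sup>2 / (2 * \<gamma>))"
      if s: "0 < s" "s \<le> 1" for s
    proof -
      \<comment> \<open>Global optimality is tested at the shrunken point instead of
        \<open>v\<close>: local conicity makes the increment of \<open>f\<close> scale by
        \<open>s\<close>, as the linear term does, while the quadratic term scales by
        \<open>s\<^sup>2\<close>.\<close>
      have "f u \<le> f (u + s *\<^sub>R (v - u)) + lam \<bullet> (s *\<^sub>R (v - u))
          + (norm (s *\<^sub>R (v - u)))\<^sup>2 / (2 * \<gamma>)"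
        using u unfolding prox_iff[OF \<gamma>] by (metis add_diff_cancel_left')
      then show ?thesis
        using conic[OF v, of s] s by (simp add: power_mult_distrib distrib_left)
    qed
    then have "0 \<le> f v - f u + lam \<bullet> (v - u)"
      by (rule nonneg_if_scaled_quadratic_nonneg)
    then show ?thesis
      by simp
  qed
  with e that show thesis
    by blast
qed

text \<open>The two sides differ by half the square of \<open>norm (v - w)\<close>.\<close>

lemma half_norm_square_ge_tangent:
  fixes v w :: "'a::real_inner"
  shows "1 / 2 * (norm w)\<^sup>2 + w \<bullet> (v - w) \<le> 1 / 2 * (norm v)\<^sup>2"
  using zero_le_power2[of "norm (v - w)"]
  by (simp add: power2_norm_eq_inner inner_diff_left inner_diff_right inner_commute)

theorem theorem2:
  fixes x :: "real ^ 'n ^ 'm" and y :: "real ^ 'm" and C \<gamma> :: real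
    and w :: "real ^ 'n" and b :: real and u lam :: "real ^ 'm"
  assumes "\<And>i. y $ i \<in> {-1, 1}"
    and "C > 0"
    and "\<gamma> > 0"
    and "P_stationary x y C (w, b, u) lam \<gamma>"
  shows "local_minimizer_on (objective C) (feasible_set x y) (w, b, u)"
proof -
  let ?A = "data_matrix x y"
  have w: "w + transpose ?A *v lam = 0" and y: "y \<bullet> lam = 0"
    and feas: "u + ?A *v w + b *\<^sub>R y = 1"
    and u: "u \<in> prox \<gamma> (\<lambda>v. C * total_ramp_loss v) (u - \<gamma> *\<^sub>R lam)"
    using assms(4) by (auto simp: P_stationary_def)
  have "locally_conic (\<lambda>v. C * total_ramp_loss v) u"
    unfolding total_ramp_loss_def
    by (intro locally_conic_cmult locally_conic_sum_components locally_conic_ramp_loss)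
  then obtain e where e: "e > 0" and
    first_order: "\<And>v. norm (v - u) < e \<Longrightarrow>
      C * total_ramp_loss u \<le> C * total_ramp_loss v + lam \<bullet> (v - u)"
    using prox_locally_conic[OF assms(3) u] by blast
  have "objective C (w, b, u) \<le> objective C (w', b', u')"
    if feas': "(w', b', u') \<in> feasible_set x y" and near: "(w', b', u') \<in> ball (w, b, u) e"
    for w' b' u'
  proof -
    have "u' + ?A *v w' + b' *\<^sub>R y = 1"
      using feas' by (simp add: feasible_set_def)
    then have diff: "?A *v (w' - w) = - (u' - u) - (b' - b) *\<^sub>R y"
      using feas by (simp add: matrix_vector_mult_diff_distrib algebra_simps)
    \<comment> \<open>Stationarity in \<open>w\<close> moves the pairing through the adjoint to
      \<open>lam\<close>; the difference of the two constraints then replaces the image under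
      \<open>?A\<close>, and its part along \<open>y\<close> vanishes by orthogonality to
      \<open>lam\<close>.\<close>
    have "w \<bullet> (w' - w) = - ((transpose ?A *v lam) \<bullet> (w' - w))"
      using w by (metis add_eq_0_iff2 inner_minus_left)
    also have "\<dots> = - (lam \<bullet> (?A *v (w' - w)))"
      by (simp add: dot_lmul_matrix)
    also have "\<dots> = lam \<bullet> (u' - u)"
      using y unfolding diff by (simp add: inner_diff_right inner_commute)
    finally have "w \<bullet> (w' - w) = lam \<bullet> (u' - u)" .
    \<comment> \<open>Projecting the nested product onto its last component does not increase
      distances, so the radius for \<open>u\<close> also serves for the triple.\<close>
    moreover have "dist u u' < e"
      using near dist_snd_le[of "(w, b, u)" "(w', b', u')"] dist_snd_le[of "(b, u)" "(b', u')"]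
      by simp
    then have "C * total_ramp_loss u \<le> C * total_ramp_loss u' + lam \<bullet> (u' - u)"
      by (intro first_order) (simp add: dist_norm norm_minus_commute)
    ultimately show ?thesis
      using half_norm_square_ge_tangent[of w w'] by (simp add: objective_def)
  qed
  then show ?thesis
    using e feas by (auto simp: local_minimizer_on_def feasible_set_def)
qed

end
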